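(* Let $q\ge2$, $d\ge2$, $n\ge1$ be integers, let $0\le r<w_{n+1}$, let $\mathbf{x}\in A^n$ with $M(\mathbf{x})\equiv r\pmod{w_{n+1}}$, and let $\mathbf{y}$ be a word over $A$ obtained from $\mathbf{x}$ by a total of at most $d$ insertions and deletions. Let $a=\left\lfloor\frac{d+len(\mathbf{y})-n}{2}\right\rfloor$ and assume $a\le len(\mathbf{y})$. Let $\tilde{\mathbf{x}}$ be the word obtained from $\mathbf{y}$ by the following $a$ deletions, which minimize the moment of the resulting word among all words obtained from $\mathbf{y}$ by $a$ deletions: starting with $\mathbf{y}'=\mathbf{y}$, repeat $a$ times: let $i>0$ be the lowest integer such that $y'_j\ge y'_{j+1}$ for all $i\le j<len(\mathbf{y}')$, and delete the $i$-th symbol of $\mathbf{y}'$; $\tilde{\mathbf{x}}$ is the final $\mathbf{y}'$. Then: 1. If $M(\tilde{\mathbf{x}})>r$, then $M(\mathbf{x})=r+w_{n+1}$. 2. If $M(\tilde{\mathbf{x}})\le r$, then $M(\mathbf{x})=r$.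
   Context: Put $p=q-1$ and $A=\{0,1,\dots,p\}$. The weights $w_i=w_i(q,d)$ are defined by $w_i=0$ for $i\le 0$ and $w_i=1+p\sum_{j=1}^{d}w_{i-j}$ for $i\ge1$. The moment of a word $\mathbf{z}=(z_1,\dots,z_\ell)$ over $A$ of any length $\ell$ is $M(\mathbf{z})=\sum_{i=1}^{\ell} z_iw_i$. $len(\mathbf{s})$ is the number of symbols of $\mathbf{s}$. *)

theory Defs
  imports Main "HOL-Number_Theory.Cong"
begin

text \<open>
  The weights are only needed at indices \<open>i \<ge> 0\<close>: a term \<open>w\<^sub>i\<^sub>-\<^sub>j\<close> with \<open>i - j \<le> 0\<close> is zero,
  and truncated subtraction turns it into \<open>weight q d 0 = 0\<close>.
\<close>

function weight :: "nat \<Rightarrow> nat \<Rightarrow> nat \<Rightarrow> nat" where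
  "weight q d i = (if i = 0 then 0 else 1 + (q - 1) * (\<Sum>j\<in>{1..d}. weight q d (i - j)))"
  by pat_completeness auto
termination
  by (relation "measure (\<lambda>(q, d, i). i)") auto

declare weight.simps [simp del]

definition alphabet :: "nat \<Rightarrow> nat set" where
  "alphabet q = {0..q - 1}"

text \<open>Lists are indexed from 0, so the \<open>i\<close>-th symbol of \<open>z\<close> is \<open>z ! (i - 1)\<close>.\<close>

definition moment :: "nat \<Rightarrow> nat \<Rightarrow> nat list \<Rightarrow> nat" where
  "moment q d z = (\<Sum>i = 1..length z. z ! (i - 1) * weight q d i)"

definition deletion :: "'a list \<Rightarrow> 'a list \<Rightarrow> bool" where
  "deletion u v \<longleftrightarrow> (\<exists>s c t. u = s @ [c] @ t \<and> v = s @ t)"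

definition insertion :: "'a set \<Rightarrow> 'a list \<Rightarrow> 'a list \<Rightarrow> bool" where
  "insertion A u v \<longleftrightarrow> (\<exists>s t. \<exists>c\<in>A. u = s @ t \<and> v = s @ [c] @ t)"

definition indel :: "'a set \<Rightarrow> 'a list \<Rightarrow> 'a list \<Rightarrow> bool" where
  "indel A u v \<longleftrightarrow> insertion A u v \<or> deletion u v"

text \<open>
  The 1-based starting position of the longest non-increasing suffix of \<open>y\<close>, for nonempty \<open>y\<close>.
\<close>

definition min_del_pos :: "nat list \<Rightarrow> nat" where
  "min_del_pos y = (LEAST i. i > 0 \<and> (\<forall>j. i \<le> j \<and> j < length y \<longrightarrow> y ! (j - 1) \<ge> y ! j))"

definition min_del :: "nat list \<Rightarrow> nat list" where
  "min_del y = take (min_del_pos y - 1) y @ drop (min_del_pos y) y"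

end

theory Submission
  imports Defs "HOL-Library.Sublist"
begin

text \<open>
  Deleting a symbol never increases the moment, and deleting one symbol from a word of length
  \<open>l\<close> decreases it by at most \<open>(q - 1) * w\<^sub>l\<close>.  Hence at most \<open>d\<close> deletions from \<open>x\<close> cost less
  than \<open>w\<^sub>n\<^sub>+\<^sub>1\<close>.  The words \<open>x\<close> and \<open>y\<close> share a subsequence of length at least
  \<open>length y - a\<close>, so the minimality of \<open>xt\<close> gives \<open>M(xt) \<le> M(x)\<close>; and \<open>x\<close> and \<open>xt\<close>, through
  \<open>y\<close>, share a subsequence of length at least \<open>n - d\<close>, so \<open>M(x) < M(xt) + w\<^sub>n\<^sub>+\<^sub>1\<close>.
  As \<open>M(x) < 2 * w\<^sub>n\<^sub>+\<^sub>1\<close>, the residue \<open>r\<close> leaves two candidates for \<open>M(x)\<close>, and these two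
  inequalities separate them.  Minimality of the greedy deletions is an exchange argument: every
  proper subsequence of \<open>y\<close> can be replaced, without changing the length or increasing the
  moment, by one that avoids the symbol deleted first.
\<close>

section \<open>Subsequences and common subsequences\<close>

lemma subseq_set_subset: "subseq u v \<Longrightarrow> set u \<subseteq> set v"
  by (induction rule: list_emb.induct) auto

text \<open>Scanning \<open>s\<close> from the right, the symbols that \<open>z\<close> uses form
  \<open>u\<close>, and the first one it skips becomes \<open>e\<close>. The condition on
  \<open>last\<close> serves the comparison with \<open>c\<close> in the exchange argument.\<close>

lemma subseq_extend_last:
  assumes "subseq z s" "length z < length s"
  shows "\<exists>z0 e u. z = z0 @ u \<and> subseq (z0 @ e # u) s \<and> last (e # u) = last s"
  using assms
proof (induction s arbitrary: z rule: rev_induct)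
  case (snoc f s)
  from snoc.prems(1) obtain z1 b where z: "z = z1 @ b" "subseq z1 s" "subseq b [f]"
    by (elim subseq_appendE)
  then consider "b = []" | "b = [f]"
    by (cases b) (auto elim: list_emb.cases split: if_splits)
  then show ?case
  proof cases
    case 1
    then have "subseq (z @ [f]) (s @ [f])"
      using z by simp
    then show ?thesis
      by (intro exI[of _ z] exI[of _ f] exI[of _ "[]"]) simp
  next
    case 2
    then obtain z0 e u where "z1 = z0 @ u" "subseq (z0 @ e # u) s"
      using snoc.IH[of z1] snoc.prems(2) z by auto
    then have "subseq ((z0 @ e # u) @ [f]) (s @ [f])"
      by (intro list_emb_append_mono) auto
    with 2 z \<open>z1 = z0 @ u\<close> show ?thesis
      by (intro exI[of _ z0] exI[of _ e] exI[of _ "u @ [f]"]) simp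
  qed
qed simp

text \<open>From right to left, \<open>subseq_extend_last\<close> restores one symbol of
  \<open>y\<close> to \<open>z\<close>, which undoes the last deletion.\<close>

lemma deletion_pow_iff: "(deletion ^^ k) y z \<longleftrightarrow> subseq z y \<and> length z + k = length y"
proof (induction k arbitrary: z)
  case 0
  show ?case
    by (auto dest: subseq_same_length)
next
  case (Suc k)
  have "(deletion ^^ Suc k) y z \<longleftrightarrow> (\<exists>u. (subseq u y \<and> length u + k = length y) \<and> deletion u z)"
    using Suc by (auto simp: relcompp_apply)
  also have "\<dots> \<longleftrightarrow> subseq z y \<and> length z + Suc k = length y" (is "?L \<longleftrightarrow> ?R")
  proof
    assume ?L
    then obtain s c t where "subseq (s @ [c] @ t) y" "length (s @ [c] @ t) + k = length y" "z = s @ t"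
      by (auto simp: deletion_def)
    moreover have "subseq (s @ t) (s @ [c] @ t)"
      by (intro list_emb_append_mono) auto
    ultimately show ?R
      by (auto intro: subseq_order.trans)
  next
    assume R: ?R
    then have "length z < length y" by simp
    with R obtain s c t where "z = s @ t" "subseq (s @ c # t) y"
      using subseq_extend_last[of z y] by blast
    then show ?L
      using R by (intro exI[of _ "s @ c # t"]) (auto simp: deletion_def)
  qed
  finally show ?case .
qed

text \<open>Keep the positions of \<open>y\<close> used by both words: the number lost is at most
  the sum of those lost by \<open>s\<close> and by \<open>z\<close>.\<close>

lemma subseq_common:
  assumes "subseq s y" "subseq z y"
  shows "\<exists>u. subseq u s \<and> subseq u z \<and> length s + length z \<le> length y + length u"
  using assms
proof (induction y arbitrary: s z rule: list.induct)
  case (Cons c y)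
  have tail: "\<exists>v'. subseq v' y \<and> (v = v' \<or> v = c # v')" if "subseq v (c # y)" for v
    using that by cases auto
  obtain s' where s': "subseq s' y" "s = s' \<or> s = c # s'"
    using tail[OF Cons.prems(1)] by blast
  obtain z' where z': "subseq z' y" "z = z' \<or> z = c # z'"
    using tail[OF Cons.prems(2)] by blast
  from Cons.IH[OF s'(1) z'(1)] obtain u where
    u: "subseq u s'" "subseq u z'" "length s' + length z' \<le> length y + length u"
    by blast
  show ?case
  proof (cases "s = c # s' \<and> z = c # z'")
    case True
    with u show ?thesis
      by (intro exI[of _ "c # u"]) auto
  next
    case False
    with u s' z' show ?thesis
      by (intro exI[of _ u]) auto
  qed
qed auto

text \<open>An insertion lengthens \<open>y\<close> and leaves \<open>u\<close> intact; a deletion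
  shortens \<open>y\<close> and costs \<open>u\<close> at most one symbol. Either way
  \<open>length x + length y - 2 * length u\<close> grows by at most 1.\<close>

lemma indel_pow_common_subseq:
  assumes "(indel A ^^ k) x y"
  shows "\<exists>u. subseq u x \<and> subseq u y \<and> length x + length y \<le> 2 * length u + k"
  using assms
proof (induction k arbitrary: y)
  case 0
  then show ?case by auto
next
  case (Suc k)
  then obtain y' where y': "(indel A ^^ k) x y'" "indel A y' y"
    by auto
  with Suc.IH obtain u where
    u: "subseq u x" "subseq u y'" "length x + length y' \<le> 2 * length u + k"
    by blast
  from y'(2) consider "insertion A y' y" | "deletion y' y"
    by (auto simp: indel_def)
  then show ?case
  proof cases
    case 1
    then obtain s c t where "y' = s @ t" "y = s @ [c] @ t"
      by (auto simp: insertion_def)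
    moreover have "subseq (s @ t) (s @ [c] @ t)"
      by (intro list_emb_append_mono) auto
    ultimately show ?thesis
      using u by (intro exI[of _ u]) (auto intro: subseq_order.trans)
  next
    case 2
    then have "subseq y y'" and len: "length y + 1 = length y'"
      using deletion_pow_iff[of 1 y' y] by (auto simp: relcompp_apply eq_OO)
    with u(2) obtain v where "subseq v u" "subseq v y" "length u + length y \<le> length y' + length v"
      using subseq_common by blast
    with u len show ?thesis
      by (intro exI[of _ v]) (auto intro: subseq_order.trans)
  qed
qed

section \<open>Greedy deletion\<close>

lemma min_del_split:
  assumes "y \<noteq> []"
  obtains s c t where "y = s @ c # t" "min_del y = s @ t" "sorted_wrt (\<ge>) (c # t)"
    "s \<noteq> [] \<Longrightarrow> last s < c"
proof -
  define P where "P i \<longleftrightarrow> i > 0 \<and> (\<forall>j. i \<le> j \<and> j < length y \<longrightarrow> y ! (j - 1) \<ge> y ! j)" for i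
  define i where "i = min_del_pos y"
  have i_Least: "i = (LEAST i. P i)"
    by (simp add: i_def min_del_pos_def P_def)
  have "P (length y)"
    using assms by (simp add: P_def)
  then have Pi: "P i" and i_le: "i \<le> length y"
    unfolding i_Least by (auto intro: LeastI Least_le)
  have i_pos: "i > 0"
    using Pi by (simp add: P_def)
  define s where "s = take (i - 1) y"
  define c where "c = y ! (i - 1)"
  define t where "t = drop i y"
  have ct: "c # t = drop (i - 1) y"
    using i_pos i_le Cons_nth_drop_Suc[of "i - 1" y] by (simp add: c_def t_def)
  have "y = s @ c # t"
    by (simp add: ct s_def)
  moreover have "min_del y = s @ t"
    by (simp add: min_del_def s_def t_def i_def)
  moreover have "sorted_wrt (\<ge>) (c # t)"
  proof -
    have "drop (i - 1) y ! Suc j \<le> drop (i - 1) y ! j" if "Suc j < length (drop (i - 1) y)" for j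
    proof -
      have "i \<le> i + j \<and> i + j < length y"
        using that i_pos by auto
      then have "y ! (i + j) \<le> y ! (i + j - 1)"
        using Pi unfolding P_def by blast
      then show ?thesis
        using that i_pos i_le by (simp add: add.commute)
    qed
    then show ?thesis
      unfolding ct by (subst sorted_wrt_iff_nth_Suc_transp) (auto intro: transpI)
  qed
  moreover have "last s < c" if "s \<noteq> []"
  proof -
    have i2: "i - 1 > 0"
      using that by (auto simp: s_def)
    \<comment> \<open>By leastness, monotonicity fails from \<open>i - 1\<close> on but not from
      \<open>i\<close> on, so it fails exactly between \<open>last s\<close> and
      \<open>c\<close>.\<close>
    have "\<not> P (i - 1)"
      using i_pos not_less_Least[of "i - 1" P] by (simp add: i_Least[symmetric])
    then obtain j where j: "i - 1 \<le> j" "j < length y" "y ! (j - 1) < y ! j"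
      using i2 by (auto simp: P_def not_le)
    have "\<not> i \<le> j"
      using Pi j(2,3) unfolding P_def using not_le by blast
    then have "j = i - 1"
      using j(1) by linarith
    then show ?thesis
      using j i2 i_le that by (simp add: last_conv_nth s_def c_def)
  qed
  ultimately show ?thesis
    using that by blast
qed

lemma min_del_deletion:
  assumes "y \<noteq> []"
  shows "deletion y (min_del y)"
  using min_del_split[OF assms] unfolding deletion_def by (metis append_Cons append_Nil)

lemma min_del_pow_deletion:
  assumes "a \<le> length y"
  shows "(deletion ^^ a) y ((min_del ^^ a) y)"
  using assms
proof (induction a)
  case (Suc a)
  then have "length ((min_del ^^ a) y) + a = length y"
    by (simp add: deletion_pow_iff)
  with Suc.prems have "deletion ((min_del ^^ a) y) ((min_del ^^ Suc a) y)"
    by (auto intro: min_del_deletion)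
  with Suc show ?case
    by auto
qed simp

text \<open>Take \<open>u\<close> to be \<open>v\<close> with the first skipped symbol of
  \<open>t\<close> put back. Up to that symbol, each entry of \<open>u\<close> faces its predecessor
  in \<open>c # t\<close>, which is at least as large; beyond it the two words agree.\<close>

lemma descending_shift:
  fixes t v :: "'a::preorder list"
  assumes "sorted_wrt (\<ge>) (c # t)" "subseq v t" "length v < length t"
  shows "\<exists>u. subseq u t \<and> list_all2 (\<le>) u (c # v)"
  using assms
proof (induction t arbitrary: c v)
  case (Cons e t)
  have refl: "list_all2 (\<le>) v v" for v :: "'a list"
    by (simp add: list_all2_refl)
  from Cons.prems(2) show ?case
  proof cases
    case list_emb_Nil
    then show ?thesis
      using Cons.prems by (intro exI[of _ "[e]"]) auto
  next
    case (list_emb_Cons)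
    then show ?thesis
      using Cons.prems refl by (intro exI[of _ "e # v"]) auto
  next
    case (list_emb_Cons2 a v')
    then obtain u where "subseq u t" "list_all2 (\<le>) u (e # v')"
      using Cons.IH[of e v'] Cons.prems by auto
    then show ?thesis
      using Cons.prems list_emb_Cons2 by (intro exI[of _ "e # u"]) auto
  qed
qed simp

section \<open>Moments and weights\<close>

primrec moment_from :: "nat \<Rightarrow> nat \<Rightarrow> nat \<Rightarrow> nat list \<Rightarrow> nat" where
  "moment_from q d k [] = 0"
| "moment_from q d k (c # z) = c * weight q d (Suc k) + moment_from q d (Suc k) z"

lemma moment_from_append:
  "moment_from q d k (s @ t) = moment_from q d k s + moment_from q d (k + length s) t"
  by (induction s arbitrary: k) auto

text \<open>The offset \<open>k\<close> lets a moment split over \<open>@\<close>. The induction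
  runs from the right because appending keeps the indices of earlier symbols, while prepending
  shifts them all.\<close>

lemma moment_eq_moment_from: "moment q d z = moment_from q d 0 z"
proof (induction z rule: rev_induct)
  case Nil
  show ?case by (simp add: moment_def)
next
  case (snoc c z)
  have "moment q d (z @ [c]) = moment q d z + c * weight q d (Suc (length z))"
    unfolding moment_def by (auto simp: nth_append intro!: sum.cong)
  with snoc show ?case
    by (simp add: moment_from_append)
qed

lemma moment_from_mono:
  assumes "list_all2 (\<le>) u v"
  shows "moment_from q d k u \<le> moment_from q d k v"
  using assms by (induction arbitrary: k rule: list_all2_induct) (auto intro: add_mono mult_right_mono)

lemma weight_0 [simp]: "weight q d 0 = 0"
  by (simp add: weight.simps)

lemma weight_Suc: "weight q d (Suc n) = 1 + (q - 1) * (\<Sum>j=1..d. weight q d (Suc n - j))"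
  by (subst weight.simps) simp

text \<open>The bound depends on \<open>weight q d 0 = 0\<close> when \<open>n < d\<close>.\<close>

lemma weight_sum_less:
  assumes "n \<le> m + d"
  shows "(q - 1) * (\<Sum>i\<in>{m<..n}. weight q d i) < weight q d (Suc n)"
proof -
  have "(\<Sum>i\<in>{m<..n}. weight q d i) = (\<Sum>j\<in>{1..n - m}. weight q d (Suc n - j))"
    by (rule sum.reindex_bij_witness[of _ "\<lambda>j. Suc n - j" "\<lambda>i. Suc n - i"]) auto
  also have "\<dots> \<le> (\<Sum>j=1..d. weight q d (Suc n - j))"
    using assms by (intro sum_mono2) auto
  finally show ?thesis
    by (simp add: weight_Suc less_Suc_eq_le)
qed

context
  fixes q d :: nat
  assumes q: "q \<ge> 2" and d: "d \<ge> 2"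
begin

abbreviation (input) w :: "nat \<Rightarrow> nat" where "w \<equiv> weight q d"
abbreviation (input) M :: "nat \<Rightarrow> nat list \<Rightarrow> nat" where "M \<equiv> moment_from q d"

lemma weight_growth: "(q - 1) * w n < w (Suc n)"
proof (cases n)
  case (Suc m)
  have "{m<..n} = {n}"
    using Suc by auto
  then show ?thesis
    using weight_sum_less[of n m d q] Suc d by simp
qed (simp add: weight_Suc)

lemma weight_le_Suc: "w n \<le> w (Suc n)"
proof -
  have "w n \<le> (q - 1) * w n"
    using mult_le_mono1[of 1 "q - 1" "w n"] q by (simp only: mult_1 le_diff_conv2)
  with weight_growth[of n] show ?thesis
    by linarith
qed

text \<open>Split off the two top weights. Since \<open>d \<ge> 2\<close>, their sum times
  \<open>q - 1\<close> is below the next weight, and by monotonicity so is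
  \<open>2 * w (Suc n)\<close>, which bounds the rest.\<close>

lemma weight_total: "(q - 1) * (\<Sum>i\<in>{0<..n}. w i) < 2 * w (Suc n)"
proof (induction n rule: induct_nat_012)
  case 0
  show ?case by (simp add: weight_Suc)
next
  case 1
  have "{0<..Suc 0} = {1}" by auto
  then show ?case
    using weight_growth[of 1] by simp
next
  case (ge2 n)
  have split: "{0<..Suc (Suc n)} = {0<..n} \<union> {n<..Suc (Suc n)}"
    by auto
  have "{n<..Suc (Suc n)} = {Suc n, Suc (Suc n)}"
    by auto
  then have two: "(\<Sum>i\<in>{n<..Suc (Suc n)}. w i) = w (Suc n) + w (Suc (Suc n))"
    by simp
  have "(q - 1) * (w (Suc n) + w (Suc (Suc n))) < w (Suc (Suc (Suc n)))"
    using weight_sum_less[of "Suc (Suc n)" n d q] d two by simp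
  moreover have "w (Suc n) + w (Suc (Suc n)) \<le> (q - 1) * (w (Suc n) + w (Suc (Suc n)))"
    using mult_le_mono1[of 1 "q - 1" "w (Suc n) + w (Suc (Suc n))"] q by (simp only: mult_1 le_diff_conv2)
  moreover have "(q - 1) * (\<Sum>i\<in>{0<..Suc (Suc n)}. w i)
      = (q - 1) * (\<Sum>i\<in>{0<..n}. w i) + (q - 1) * (w (Suc n) + w (Suc (Suc n)))"
    unfolding split by (subst sum.union_disjoint) (auto simp: two distrib_left)
  ultimately show ?case
    using ge2(1) weight_le_Suc[of "Suc n"] by linarith
qed

section \<open>Effect of deletions on the moment\<close>

lemma moment_from_le_Suc: "M k z \<le> M (Suc k) z"
  by (induction z arbitrary: k) (auto intro!: add_mono mult_left_mono weight_le_Suc)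

lemma moment_from_subseq_le:
  assumes "subseq v x"
  shows "M k v \<le> M k x"
  using assms
proof (induction arbitrary: k rule: list_emb.induct)
  case (list_emb_Cons v x c)
  then have "M k v \<le> M (Suc k) x"
    using moment_from_le_Suc order_trans by blast
  then show ?case by simp
qed auto

text \<open>Prepending moves each symbol up one index, a gain of at most \<open>q - 1\<close> times
  the weight difference. These gains telescope, and \<open>(q - 1) * w (Suc k)\<close>, which bounds
  the term of \<open>c\<close>, completes the sum.\<close>

lemma moment_from_Cons_le:
  assumes "set z \<subseteq> {..q - 1}" "c \<le> q - 1"
  shows "M k (c # z) \<le> M k z + (q - 1) * w (Suc k + length z)"
proof -
  have "M (Suc k) z + (q - 1) * w (Suc k) \<le> M k z + (q - 1) * w (Suc k + length z)"
    using assms(1)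
  proof (induction z arbitrary: k)
    case (Cons e z)
    then obtain e' where e': "q - 1 = e + e'"
      by (auto simp: le_iff_add)
    have "e' * w (Suc k) \<le> e' * w (Suc (Suc k))"
      by (simp add: weight_le_Suc)
    then have "e * w (Suc (Suc k)) + (q - 1) * w (Suc k) \<le> e * w (Suc k) + (q - 1) * w (Suc (Suc k))"
      unfolding e' by (simp add: algebra_simps)
    moreover have "M (Suc (Suc k)) z + (q - 1) * w (Suc (Suc k))
        \<le> M (Suc k) z + (q - 1) * w (Suc (Suc k) + length z)"
      using Cons.IH[of "Suc k"] Cons.prems by simp
    ultimately show ?case by simp
  qed simp
  moreover have "c * w (Suc k) \<le> (q - 1) * w (Suc k)"
    using assms(2) by (rule mult_right_mono) simp
  ultimately show ?thesis
    unfolding moment_from.simps by linarith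
qed

text \<open>Reinserting a symbol costs at most \<open>q - 1\<close> times the top weight of the
  longer word. The lost symbols are thus charged to consecutive top indices, the form that
  \<open>weight_sum_less\<close> takes.\<close>

lemma moment_from_subseq_bound:
  assumes "subseq v x" "set x \<subseteq> {..q - 1}"
  shows "M k x \<le> M k v + (q - 1) * (\<Sum>i\<in>{k + length v<..k + length x}. w i)"
  using assms
proof (induction arbitrary: k rule: list_emb.induct)
  case (list_emb_Nil x)
  then show ?case
  proof (induction x arbitrary: k)
    case (Cons c x)
    have "{k<..k + length (c # x)} = insert (Suc k) {Suc k<..Suc k + length x}"
      by auto
    moreover have "c * w (Suc k) \<le> (q - 1) * w (Suc k)"
      using Cons.prems by (intro mult_right_mono) auto
    ultimately show ?case
      using Cons.IH[of "Suc k"] Cons.prems by (simp add: distrib_left add_mono del: mult_le_cancel2)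
  qed simp
next
  case (list_emb_Cons v x c)
  have len: "length v \<le> length x"
    using list_emb_Cons.hyps by (rule list_emb_length)
  have "{k + length v<..k + length (c # x)} = insert (Suc (k + length x)) {k + length v<..k + length x}"
    using len by auto
  moreover have "M k (c # x) \<le> M k x + (q - 1) * w (Suc k + length x)"
    using list_emb_Cons.prems by (intro moment_from_Cons_le) auto
  ultimately show ?case
    using list_emb_Cons.IH[of k] list_emb_Cons.prems by (simp add: distrib_left)
next
  case (list_emb_Cons2 c c' v x)
  then show ?case
    using list_emb_Cons2.IH[of "Suc k"] by simp
qed

section \<open>Optimality of the greedy choice\<close>

lemma moment_from_rotate_le:
  assumes "set (e # u) \<subseteq> {..q - 1}" "last (e # u) < c"
  shows "M k (e # u) \<le> M k (u @ [c])"
proof (cases u rule: rev_cases)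
  case Nil
  with assms show ?thesis by simp
next
  case (snoc u' f)
  let ?K = "Suc k + length u'"
  have "M k (e # u') \<le> M k u' + (q - 1) * w ?K"
    using assms snoc by (intro moment_from_Cons_le) auto
  \<comment> \<open>Raising the last symbol from \<open>f\<close> to \<open>c\<close> gains at least
    \<open>w (Suc ?K)\<close>, which outweighs \<open>(q - 1) * w ?K\<close>, the most that
    \<open>e\<close> can contribute.\<close>
  moreover have "(q - 1) * w ?K + f * w (Suc ?K) \<le> c * w (Suc ?K)"
  proof -
    have "(q - 1) * w ?K + f * w (Suc ?K) \<le> Suc f * w (Suc ?K)"
      using weight_growth[of ?K] by simp
    also have "\<dots> \<le> c * w (Suc ?K)"
      using assms snoc by (intro mult_right_mono) auto
    finally show ?thesis .
  qed
  ultimately show ?thesis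
    using snoc by (simp add: moment_from_append)
qed

text \<open>A word \<open>z\<close> that keeps \<open>c\<close> must skip something else. If it
  skips a symbol of \<open>t\<close>, \<open>descending_shift\<close> replaces \<open>c\<close>. If
  it uses all of \<open>t\<close>, it skips a symbol of \<open>s\<close>, and putting one back in
  exchange for \<open>c\<close> cannot raise the moment, by
  \<open>moment_from_rotate_le\<close>.\<close>

lemma min_del_exchange:
  assumes y: "set y \<subseteq> {..q - 1}" and z: "subseq z y" "length z < length y"
  shows "\<exists>z'. subseq z' (min_del y) \<and> length z' = length z \<and> M 0 z' \<le> M 0 z"
proof -
  have "y \<noteq> []"
    using z by auto
  then obtain s c t where yst: "y = s @ c # t" and del: "min_del y = s @ t"
    and sorted: "sorted_wrt (\<ge>) (c # t)" and last: "s \<noteq> [] \<Longrightarrow> last s < c"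
    using min_del_split by blast
  from z(1) yst obtain zs zt where zst: "z = zs @ zt" "subseq zs s" "subseq zt (c # t)"
    by (auto elim: subseq_appendE)
  from zst(3) consider "subseq zt t" | zt' where "zt = c # zt'" "subseq zt' t"
    by cases auto
  then show ?thesis
  proof cases
    case 1
    then have "subseq z (s @ t)"
      using zst by (auto intro: list_emb_append_mono)
    then show ?thesis
      using del by auto
  next
    case (2 zt')
    show ?thesis
    proof (cases "length zt' < length t")
      case True
      then obtain u where u: "subseq u t" "list_all2 (\<le>) u (c # zt')"
        using descending_shift[OF sorted 2(2)] by blast
      have "subseq (zs @ u) (s @ t)"
        using zst u by (auto intro: list_emb_append_mono)
      moreover have "M 0 (zs @ u) \<le> M 0 z"
        unfolding zst 2 by (simp only: moment_from_append add_le_cancel_left moment_from_mono[OF u(2)])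
      moreover have "length (zs @ u) = length z"
        using list_all2_lengthD[OF u(2)] zst 2 by simp
      ultimately show ?thesis
        using del by metis
    next
      case False
      with 2(2) have zt': "zt' = t"
        by (metis le_neq_implies_less list_emb_length subseq_same_length)
      then have less: "length zs < length s"
        using z(2) yst zst 2 by simp
      then obtain z0 e u where zs: "zs = z0 @ u" "subseq (z0 @ e # u) s" "last (e # u) = last s"
        using subseq_extend_last[OF zst(2)] by blast
      have "set (e # u) \<subseteq> set s"
        using subseq_set_subset[OF zs(2)] by auto
      moreover have "last s < c"
        using last less by fastforce
      ultimately have rotate: "M k (e # u) \<le> M k (u @ [c])" for k
        using y yst zs(3) by (intro moment_from_rotate_le) auto
      have "M 0 (z0 @ (e # u) @ t) \<le> M 0 (z0 @ (u @ [c]) @ t)"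
        using rotate[of "0 + length z0"] unfolding moment_from_append
        by (simp del: moment_from.simps)
      moreover have "z0 @ (u @ [c]) @ t = z"
        using zst zs 2 zt' by simp
      moreover have "subseq ((z0 @ e # u) @ t) (s @ t)"
        using zs(2) by (intro list_emb_append_mono) auto
      ultimately show ?thesis
        using del by (intro exI[of _ "z0 @ (e # u) @ t"]) auto
    qed
  qed
qed

lemma min_del_pow_minimal:
  assumes "set y \<subseteq> {..q - 1}" "subseq z y" "length z + a = length y"
  shows "M 0 ((min_del ^^ a) y) \<le> M 0 z"
  using assms
proof (induction a arbitrary: y z)
  case 0
  then show ?case
    by (auto dest: subseq_same_length)
next
  case (Suc a)
  then obtain z' where z': "subseq z' (min_del y)" "length z' = length z" "M 0 z' \<le> M 0 z"
    using min_del_exchange[of y z] by auto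
  have "y \<noteq> []"
    using Suc.prems by auto
  then have "subseq (min_del y) y" "length (min_del y) + 1 = length y"
    using min_del_deletion deletion_pow_iff[of 1 y "min_del y"] by (auto simp: eq_OO)
  moreover from this have "set (min_del y) \<subseteq> {..q - 1}"
    using Suc.prems(1) subseq_set_subset by blast
  ultimately have "M 0 ((min_del ^^ a) (min_del y)) \<le> M 0 z'"
    using Suc.IH[of "min_del y" z'] z' Suc.prems by simp
  with z' show ?case
    by (simp add: funpow_swap1)
qed

end

section \<open>Decoding\<close>

theorem theorem4:
  fixes q d n r a :: nat and x y xt :: "nat list"
  assumes "q \<ge> 2" and "d \<ge> 2" and "n \<ge> 1"
    and "r < weight q d (n + 1)"
    and "x \<in> lists (alphabet q)" and "length x = n"
    and "[moment q d x = r] (mod weight q d (n + 1))"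
    and "y \<in> lists (alphabet q)"
    and "\<exists>k\<le>d. (indel (alphabet q) ^^ k) x y"
    and "int a = (int d + int (length y) - int n) div 2"
    and "a \<le> length y"
    and "xt = (min_del ^^ a) y"
  shows "is_arg_min (moment q d) (\<lambda>z. (deletion ^^ a) y z) xt
    \<and> (moment q d xt > r \<longrightarrow> moment q d x = r + weight q d (n + 1))
    \<and> (moment q d xt \<le> r \<longrightarrow> moment q d x = r)"
proof -
  note qd = assms(1,2)
  let ?M = "moment q d" and ?W = "weight q d (n + 1)"
  have x_set: "set x \<subseteq> {..q - 1}" and y_set: "set y \<subseteq> {..q - 1}"
    using assms(5,8) by (auto simp: alphabet_def)
  have xt_del: "(deletion ^^ a) y xt"
    using min_del_pow_deletion assms(11,12) by simp
  then have xt: "subseq xt y" "length xt + a = length y"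
    by (simp_all add: deletion_pow_iff)
  have minimal: "?M xt \<le> ?M z" if "subseq z y" "length z + a = length y" for z
    using min_del_pow_minimal[OF qd y_set that] assms(12) by (simp add: moment_eq_moment_from)
  have arg_min: "is_arg_min ?M (\<lambda>z. (deletion ^^ a) y z) xt"
    using xt_del minimal by (auto simp: is_arg_min_def deletion_pow_iff not_less)
  obtain u where u: "subseq u x" "subseq u y" "n + length y \<le> 2 * length u + d"
    using indel_pow_common_subseq assms(6,9) by fastforce
  have lower: "?M xt \<le> ?M x"
  proof -
    \<comment> \<open>Minimality compares only words of length \<open>length y - a\<close>, so
      \<open>u\<close> is cut to that length.\<close>
    let ?z = "take (length y - a) u"
    \<comment> \<open>The bounds add up to \<open>2 * (length u + a) \<ge> 2 * length y - 1\<close>;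
      parity absorbs the loss from the floor.\<close>
    have "length y \<le> length u + a"
      using u(3) assms(10) by linarith
    then have "length ?z + a = length y"
      using assms(11) by simp
    moreover have "subseq ?z u"
      by (intro prefix_imp_subseq take_is_prefix)
    ultimately have "?M xt \<le> ?M ?z" "subseq ?z x"
      using u minimal subseq_order.trans by blast+
    moreover from this have "?M ?z \<le> ?M x"
      using moment_from_subseq_le[OF qd] by (simp add: moment_eq_moment_from)
    ultimately show ?thesis by linarith
  qed
  have upper: "?M x < ?M xt + ?W"
  proof -
    obtain v where v: "subseq v u" "subseq v xt" "length u + length xt \<le> length y + length v"
      using subseq_common u(2) xt(1) by blast
    \<comment> \<open>As \<open>a\<close> is at most half of \<open>d + length y - n\<close>, the
      lower bound \<open>length u - a\<close> for \<open>length v\<close> is at least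
      \<open>n - d\<close>.\<close>
    have "length x \<le> length v + d"
      using u(3) v(3) xt(2) assms(6,10) by linarith
    then have "(q - 1) * (\<Sum>i\<in>{length v<..length x}. weight q d i) < ?W"
      using weight_sum_less assms(6) by (metis Suc_eq_plus1)
    moreover have "subseq v x"
      using v u subseq_order.trans by blast
    then have "?M x \<le> ?M v + (q - 1) * (\<Sum>i\<in>{length v<..length x}. weight q d i)"
      using moment_from_subseq_bound[OF qd _ x_set, of v 0] by (simp add: moment_eq_moment_from)
    moreover have "?M v \<le> ?M xt"
      using moment_from_subseq_le[OF qd v(2)] by (simp add: moment_eq_moment_from)
    ultimately show ?thesis by linarith
  qed
  \<comment> \<open>With the empty word as subsequence, every position of \<open>x\<close> is
    charged, and \<open>weight_total\<close> bounds the sum.\<close>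
  have total: "?M x < 2 * ?W"
    using moment_from_subseq_bound[OF qd _ x_set, of "[]" 0] weight_total[OF qd, of n] assms(6)
    by (simp add: moment_eq_moment_from)
  have "?M x = r \<or> ?M x = r + ?W"
  proof -
    have "?M x mod ?W = r"
      using assms(4,7) by (simp add: cong_def)
    moreover have "?M x div ?W < 2"
      using total by (simp add: less_mult_imp_div_less)
    then have "?M x div ?W = 0 \<or> ?M x div ?W = 1"
      by linarith
    ultimately show ?thesis
      using div_mult_mod_eq[of "?M x" ?W] by auto
  qed
  \<comment> \<open>\<open>lower\<close> excludes \<open>r\<close> when \<open>?M xt > r\<close>;
    \<open>upper\<close> excludes \<open>r + ?W\<close> when \<open>?M xt \<le> r\<close>.\<close>
  then show ?thesis
    using arg_min lower upper by auto
qed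

end
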